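(* Let $n$ be a positive integer and let $H\in\mathfrak{so}(n,\mathbb{C})$ be a semisimple element. Then $H$ is strongly $\mathrm{Ad}_{\mathrm{SO}(n,\mathbb{C})}$-real if and only if either $0$ is an eigenvalue of $H$ or $n\not\equiv 2\pmod 4$.
   Context: $\mathrm{SO}(n,\mathbb{C})=\{g\in\mathrm{SL}_n(\mathbb{C}) : g^t g=\mathrm{I}_n\}$, where $g^t$ is the transpose, with Lie algebra $\mathfrak{so}(n,\mathbb{C})=\{z\in\mathfrak{sl}_n(\mathbb{C}) : z^t+z=0\}$. An element is semisimple if it is diagonalizable as a complex $n\times n$ matrix. For a Lie group $G$ with Lie algebra $\mathfrak{g}$, an element $X\in\mathfrak{g}$ is called $\mathrm{Ad}_G$-real if $-X=\mathrm{Ad}(g)X$ for some $g\in G$. An $\mathrm{Ad}_G$-real element $X$ is called strongly $\mathrm{Ad}_G$-real if $-X=\mathrm{Ad}(\tau)X$ for some $\tau\in G$ with $\tau^2=\mathrm{Id}$. For a linear Lie group, $\mathrm{Ad}(g)X=gXg^{-1}$. *)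

theory Defs
  imports
    Complex_Main
    "HOL-Number_Theory.Cong"
    "Jordan_Normal_Form.Char_Poly"
    "Jordan_Normal_Form.Gauss_Jordan_Elimination"
begin

definition mat_trace :: "'a :: comm_monoid_add mat \<Rightarrow> 'a" where
  "mat_trace A = (\<Sum>i<dim_row A. A $$ (i, i))"

definition SL :: "nat \<Rightarrow> complex mat set" where
  "SL n = {g \<in> carrier_mat n n. det g = 1}"

definition SO :: "nat \<Rightarrow> complex mat set" where
  "SO n = {g \<in> SL n. transpose_mat g * g = 1\<^sub>m n}"

definition sl_alg :: "nat \<Rightarrow> complex mat set" where
  "sl_alg n = {z \<in> carrier_mat n n. mat_trace z = 0}"

definition so_alg :: "nat \<Rightarrow> complex mat set" where
  "so_alg n = {z \<in> sl_alg n. transpose_mat z + z = 0\<^sub>m n n}"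

definition semisimple_mat :: "complex mat \<Rightarrow> bool" where
  "semisimple_mat A \<longleftrightarrow> (\<exists>D. diagonal_mat D \<and> similar_mat A D)"

(* mat_inverse returns an option; it is None only for non-invertible matrices,
   so the selector is harmless for g in a linear group. *)
definition Ad :: "complex mat \<Rightarrow> complex mat \<Rightarrow> complex mat" where
  "Ad g X = g * X * the (mat_inverse g)"

(* In the next two definitions G is a linear group of square matrices of some fixed
   size n, so dim_row \<tau> = n for \<tau> \<in> G, and X is meant to lie in its Lie algebra. *)
definition Ad_real :: "complex mat set \<Rightarrow> complex mat \<Rightarrow> bool" where
  "Ad_real G X \<longleftrightarrow> (\<exists>g\<in>G. - X = Ad g X)"

definition strongly_Ad_real :: "complex mat set \<Rightarrow> complex mat \<Rightarrow> bool" where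
  "strongly_Ad_real G X \<longleftrightarrow>
     Ad_real G X \<and> (\<exists>\<tau>\<in>G. \<tau> * \<tau> = 1\<^sub>m (dim_row \<tau>) \<and> - X = Ad \<tau> X)"

end

theory Submission
  imports Defs "Jordan_Normal_Form.Schur_Decomposition"
begin

text \<open>
  An involution \<open>t\<close> has only the eigenvalues \<open>1\<close> and \<open>-1\<close>, so its trace and its determinant carry the
  same information: if \<open>-1\<close> has multiplicity \<open>q\<close>, the trace is \<open>n - 2q\<close> and the determinant is
  \<open>(-1)^q\<close> (\<open>involution_trace_det\<close>). Reality of \<open>H\<close> by an involution \<open>t\<close> means that \<open>t\<close>
  anticommutes with \<open>H\<close>, and an orthogonal involution is the same as a symmetric involution
  (\<open>strongly_Ad_real_SO_iff\<close>). Hence everything is decided by traces.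

  If \<open>H\<close> is invertible, \<open>t\<close> is conjugate to \<open>-t\<close> by \<open>H\<close>, so its trace vanishes
  (\<open>mat_trace_anticommuting_zero\<close>), \<open>n = 2q\<close>, and the determinant is \<open>1\<close> exactly when \<open>n\<close> is not
  \<open>2\<close> modulo \<open>4\<close>. It remains to have some symmetric involution that anticommutes with \<open>H\<close>. For
  this, note that the symmetric bilinear form pairs the eigenspaces of \<open>c\<close> and \<open>-c\<close> and
  is nondegenerate on the kernel. Choosing one of \<open>c\<close>, \<open>-c\<close> for each nonzero eigenvalue splits the
  space into isotropic halves \<open>V\<close> and \<open>V'\<close> and the kernel, and the involution exchanges \<open>V\<close> and
  \<open>V'\<close> and fixes the kernel pointwise (\<open>swap_involution\<close>, \<open>semisimple_skew_swap\<close>).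

  If \<open>H\<close> is singular, the determinant of this involution may be \<open>-1\<close>. The kernel then contains a
  vector \<open>v\<close> that is not isotropic, and composing with the reflection along \<open>v\<close> keeps all properties
  while lowering the trace by \<open>2\<close>, which flips the determinant (\<open>reflect_involution\<close>).
\<close>

section \<open>Traces and determinants of involutions\<close>

text \<open>
  The simplifier associates products to the right; this turns an equation for \<open>X * Y\<close> into a rewrite
  rule that still applies inside such a product.
\<close>
lemma mult_eq_extend:
  fixes X :: "'a :: semiring_1 mat"
  assumes "X * Y = R" "X \<in> carrier_mat n n" "Y \<in> carrier_mat n n" "K \<in> carrier_mat n n"
  shows "X * (Y * K) = R * K"
  using assms assoc_mult_mat[of X n n Y n K n] by simp

lemma mat_trace_mult_commute:
  fixes A B :: "'a :: comm_semiring_0 mat"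
  assumes "A \<in> carrier_mat n m" "B \<in> carrier_mat m n"
  shows "mat_trace (A * B) = mat_trace (B * A)"
proof -
  have "mat_trace (A * B) = (\<Sum>i<n. \<Sum>k<m. A $$ (i, k) * B $$ (k, i))"
    using assms by (simp add: mat_trace_def scalar_prod_def atLeast0LessThan)
  also have "\<dots> = (\<Sum>k<m. \<Sum>i<n. B $$ (k, i) * A $$ (i, k))"
    by (subst sum.swap) (simp add: mult.commute)
  also have "\<dots> = mat_trace (B * A)"
    using assms by (simp add: mat_trace_def scalar_prod_def atLeast0LessThan)
  finally show ?thesis .
qed

lemma mat_trace_similar:
  fixes A B :: "'a :: comm_semiring_1 mat"
  assumes "similar_mat A B"
  shows "mat_trace A = mat_trace B"
proof -
  obtain n P Q where car: "A \<in> carrier_mat n n" "B \<in> carrier_mat n n"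
      "P \<in> carrier_mat n n" "Q \<in> carrier_mat n n"
    and QP: "Q * P = 1\<^sub>m n" and A: "A = P * B * Q"
    using similar_matD[OF assms] by blast
  have "mat_trace A = mat_trace (Q * (P * B))"
    unfolding A using car by (intro mat_trace_mult_commute[of _ n n]) auto
  also have "Q * (P * B) = B"
    using mult_eq_extend[OF QP, of n B] car by simp
  finally show ?thesis .
qed

lemma mat_trace_uminus:
  fixes A :: "'a :: ab_group_add mat"
  assumes "A \<in> carrier_mat n n"
  shows "mat_trace (- A) = - mat_trace A"
  using assms by (simp add: mat_trace_def sum_negf)

lemma sum_and_prod_of_signs:
  fixes d :: "'b \<Rightarrow> 'a :: comm_ring_1"
  assumes "finite I" "\<And>i. i \<in> I \<Longrightarrow> d i = 1 \<or> d i = -1"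
  shows "\<exists>q. sum d I = of_nat (card I) - 2 * of_nat q \<and> prod d I = (-1) ^ q"
  using assms
proof (induction I rule: finite_induct)
  case empty
  show ?case by (intro exI[of _ 0]) simp
next
  case (insert x I)
  then obtain q where q: "sum d I = of_nat (card I) - 2 * of_nat q" "prod d I = (-1) ^ q"
    by auto
  have "d x = 1 \<or> d x = -1" using insert by blast
  thus ?case
  proof
    assume "d x = 1"
    thus ?thesis using insert q by (intro exI[of _ q]) simp
  next
    assume "d x = -1"
    thus ?thesis using insert q by (intro exI[of _ "Suc q"]) simp
  qed
qed

text \<open>
  The matrix is triangularized over the complex numbers: the diagonal of a triangular involution
  consists of signs, and \<open>q\<close> counts the negative ones.
\<close>
lemma involution_trace_det:
  fixes A :: "complex mat"
  assumes A: "A \<in> carrier_mat n n" and AA: "A * A = 1\<^sub>m n"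
  obtains q where "mat_trace A = of_nat n - 2 * of_nat q" "det A = (-1) ^ q"
proof -
  obtain es where "char_poly A = (\<Prod>a\<leftarrow>es. [:- a, 1:])"
    using char_poly_factorized[OF A] by blast
  then obtain B where B: "B \<in> carrier_mat n n" and ut: "upper_triangular B"
    and sim: "similar_mat A B"
    using schur_decomposition_exists[OF A] by blast
  obtain P Q where w: "similar_mat_wit A B P Q" using sim unfolding similar_mat_def by blast
  note PQ = similar_mat_witD2[OF A w]
  have B_eq: "B = Q * A * P"
    using similar_mat_witD2(3)[OF B similar_mat_wit_sym[OF w]] .
  have APQ: "A * (P * (Q * K)) = A * K" if "K \<in> carrier_mat n n" for K
    using mult_eq_extend[OF PQ(1,6,7) that] that by simp
  have "B * B = Q * (A * (P * (Q * (A * P))))"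
    unfolding B_eq using PQ(4-7) by (simp add: assoc_mult_mat[of _ n n _ n _ n])
  also have "\<dots> = Q * (A * (A * P))" using APQ PQ(4-7) by simp
  also have "\<dots> = 1\<^sub>m n" using mult_eq_extend[OF AA A A PQ(6)] PQ by simp
  finally have BB: "B * B = 1\<^sub>m n" .
  have "B $$ (i, i) * B $$ (i, i) = 1" if i: "i < n" for i
  proof -
    have "(B * B) $$ (i, i) = (\<Sum>k\<in>{0..<n}. B $$ (i, k) * B $$ (k, i))"
      using B i by (simp add: scalar_prod_def)
    also have "\<dots> = (\<Sum>k\<in>{i}. B $$ (i, k) * B $$ (k, i))"
    proof (rule sum.mono_neutral_right)
      show "\<forall>k\<in>{0..<n} - {i}. B $$ (i, k) * B $$ (k, i) = 0"
      proof
        fix k assume "k \<in> {0..<n} - {i}"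
        hence "k < n" "k < i \<or> i < k" by auto
        thus "B $$ (i, k) * B $$ (k, i) = 0"
          using upper_triangularD[OF ut] B i by auto
      qed
    qed (use i in auto)
    finally show ?thesis using BB i by simp
  qed
  hence "B $$ (i, i) = 1 \<or> B $$ (i, i) = -1" if "i \<in> {..<n}" for i
    using that by (metis lessThan_iff square_eq_1_iff)
  then obtain q where q: "(\<Sum>i<n. B $$ (i, i)) = of_nat n - 2 * of_nat q"
      "(\<Prod>i<n. B $$ (i, i)) = (-1) ^ q"
    using sum_and_prod_of_signs[of "{..<n}" "\<lambda>i. B $$ (i, i)"] by auto
  show thesis
  proof
    show "mat_trace A = of_nat n - 2 * of_nat q"
      unfolding mat_trace_similar[OF sim] unfolding mat_trace_def using q(1) B by simp
    have "det B = (\<Prod>i<n. B $$ (i, i))"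
      using B by (simp add: det_upper_triangular[OF ut B] prod_list_diag_prod atLeast0LessThan)
    thus "det A = (-1) ^ q"
      using q(2) by (simp add: det_similar[OF sim])
  qed
qed

text \<open>
  Anticommutation means \<open>H\<^sup>-\<^sup>1 A H = - A\<close>, and conjugate matrices have the same trace.
\<close>
lemma mat_trace_anticommuting_zero:
  fixes A H :: "complex mat"
  assumes A: "A \<in> carrier_mat n n" and H: "H \<in> carrier_mat n n"
    and inv: "det H \<noteq> 0" and anti: "A * H = - (H * A)"
  shows "mat_trace A = 0"
proof -
  obtain K where K: "K \<in> carrier_mat n n" and HK: "H * K = 1\<^sub>m n"
    using det_non_zero_imp_unit[OF H inv] unfolding Units_def ring_mat_def by auto
  have KH: "K * H = 1\<^sub>m n" by (rule mat_mult_left_right_inverse[OF H K HK])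
  have "mat_trace A = mat_trace ((A * H) * K)"
    using A H K HK by (simp add: assoc_mult_mat[of _ n n _ n _ n])
  also have "\<dots> = mat_trace (K * (A * H))"
    using A H K by (intro mat_trace_mult_commute[of _ n n]) auto
  also have "K * (A * H) = - (K * (H * A))"
    unfolding anti using A H K by simp
  also have "K * (H * A) = A"
    using mult_eq_extend[OF KH K H A] A by simp
  finally show ?thesis using mat_trace_uminus[OF A] by simp
qed

section \<open>Strong reality as anticommutation with a symmetric involution\<close>

lemma eigenvalue_0_iff_det:
  fixes H :: "'a :: field mat"
  assumes H: "H \<in> carrier_mat n n"
  shows "eigenvalue H 0 \<longleftrightarrow> det H = 0"
proof -
  have "char_matrix H 0 = H" unfolding char_matrix_def using H by (intro eq_matI) auto
  thus ?thesis using eigenvalue_det[OF H, of 0] by simp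
qed

lemma Ad_SO:
  assumes g: "g \<in> SO n"
  shows "Ad g X = g * X * transpose_mat g"
proof -
  have car: "g \<in> carrier_mat n n" and orth: "transpose_mat g * g = 1\<^sub>m n" and det: "det g = 1"
    using g by (auto simp: SO_def SL_def)
  obtain B where B: "mat_inverse g = Some B"
    using mat_inverse(1)[OF car, of undefined] det_non_zero_imp_unit[OF car, of undefined] det
    by (cases "mat_inverse g") auto
  have gB: "g * B = 1\<^sub>m n" and Bc: "B \<in> carrier_mat n n" using mat_inverse(2)[OF car B] by auto
  have "transpose_mat g = (transpose_mat g * g) * B"
    using gB car Bc by (simp add: assoc_mult_mat[of _ n n _ n _ n])
  thus ?thesis using orth Bc by (simp add: Ad_def B)
qed

text \<open>
  For an involution the inverse is the matrix itself, for an orthogonal matrix it is the transpose;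
  so an orthogonal involution is symmetric, and the condition on \<open>Ad\<close> loses its inverse.
\<close>
lemma strongly_Ad_real_SO_iff:
  assumes H: "H \<in> carrier_mat n n"
  shows "strongly_Ad_real (SO n) H \<longleftrightarrow>
    (\<exists>t\<in>carrier_mat n n. transpose_mat t = t \<and> t * t = 1\<^sub>m n \<and> t * H = - (H * t) \<and> det t = 1)"
    (is "?L \<longleftrightarrow> ?R")
proof
  assume ?L
  then obtain t where t: "t \<in> SO n" and tt: "t * t = 1\<^sub>m (dim_row t)" and "- H = Ad t H"
    unfolding strongly_Ad_real_def by blast
  hence car: "t \<in> carrier_mat n n" and orth: "transpose_mat t * t = 1\<^sub>m n" and "det t = 1"
    and eq: "- H = t * H * transpose_mat t"
    by (auto simp: SO_def SL_def Ad_SO)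
  have tt: "t * t = 1\<^sub>m n" using tt car by simp
  have "transpose_mat t = (transpose_mat t * t) * t"
    using tt car by (simp add: assoc_mult_mat[of _ n n _ n _ n])
  hence sym: "transpose_mat t = t" using orth car by simp
  have "(- H) * t = (t * H) * (t * t)"
    unfolding eq sym using car H by (simp add: assoc_mult_mat[of _ n n _ n _ n])
  hence "t * H = - (H * t)" using tt car H by simp
  thus ?R using car sym tt \<open>det t = 1\<close> by blast
next
  assume ?R
  then obtain t where car: "t \<in> carrier_mat n n" and sym: "transpose_mat t = t"
    and tt: "t * t = 1\<^sub>m n" and anti: "t * H = - (H * t)" and det: "det t = 1"
    by blast
  have SO: "t \<in> SO n" using car sym tt det by (simp add: SO_def SL_def)
  have "Ad t H = - (H * (t * t))"
    using car H by (simp add: Ad_SO[OF SO] sym anti assoc_mult_mat[of _ n n _ n _ n])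
  hence "- H = Ad t H" using tt H by simp
  thus ?L using SO tt car unfolding strongly_Ad_real_def Ad_real_def by auto
qed

section \<open>An involution exchanging opposite eigenspaces\<close>

text \<open>
  Here \<open>e\<close>, \<open>f\<close>, \<open>z\<close> play the part of the projections onto \<open>V\<close>, \<open>V'\<close> and the kernel of \<open>H\<close>.
  The matrix \<open>S\<close> maps \<open>V'\<close> to \<open>V\<close>, since \<open>e S = S f\<close>, and reverses the sign of \<open>H\<close>. The involution
  acts as \<open>S\<close> on \<open>V'\<close>, as the inverse of \<open>S\<close> on \<open>V\<close>, and as the identity on the kernel.
  It is symmetric because each of the three summands is: transposing \<open>e S\<close> gives \<open>S f = e S\<close>.
\<close>
lemma swap_involution:
  fixes e f z S S' H :: "complex mat"
  assumes car: "e \<in> carrier_mat n n" "f \<in> carrier_mat n n" "z \<in> carrier_mat n n"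
      "S \<in> carrier_mat n n" "S' \<in> carrier_mat n n" "H \<in> carrier_mat n n"
    and one: "e + f + z = 1\<^sub>m n"
    and ee: "e * e = e" and ff: "f * f = f" and zz: "z * z = z"
    and ef: "e * f = 0\<^sub>m n n" and fe: "f * e = 0\<^sub>m n n" and ez: "e * z = 0\<^sub>m n n"
    and ze: "z * e = 0\<^sub>m n n" and fz: "f * z = 0\<^sub>m n n" and zf: "z * f = 0\<^sub>m n n"
    and SS': "S * S' = 1\<^sub>m n" and Ssym: "transpose_mat S = S"
    and eT: "transpose_mat e = f" and zT: "transpose_mat z = z"
    and eS: "e * S = S * f" and SH: "S * H = - (H * S)"
    and He: "H * e = e * H" and Hf: "H * f = f * H"
    and Hz: "H * z = 0\<^sub>m n n" and zH: "z * H = 0\<^sub>m n n"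
  defines "t \<equiv> e * S + f * S' + z"
  shows "t \<in> carrier_mat n n" "transpose_mat t = t" "t * t = 1\<^sub>m n"
    "t * H = - (H * t)" "t * z = z"
proof -
  note am = assoc_mult_mat[of _ n n _ n _ n]
  note mext = mult_eq_extend[where n = n]
  have S'S: "S' * S = 1\<^sub>m n" by (rule mat_mult_left_right_inverse[OF car(4,5) SS'])
  have S'sym: "transpose_mat S' = S'"
  proof -
    have inv: "transpose_mat S' * S = 1\<^sub>m n"
      using SS' S'S transpose_mult[OF car(4,5)] Ssym by simp
    have "transpose_mat S' * (S * S') = S'" using mext[OF inv, of S'] car by simp
    thus ?thesis using SS' car by simp
  qed
  have fS': "f * S' = S' * e"
  proof -
    have "f * S' = S' * (S * f) * S'" using mext[OF S'S] car by simp
    also have "\<dots> = S' * (e * (S * S'))" unfolding eS[symmetric] using car by (simp add: am)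
    finally show ?thesis using SS' car by simp
  qed
  have S'H: "S' * H = - (H * S')"
  proof -
    have "S' * H = S' * (H * S) * S'" using SS' car by (simp add: am)
    also have "H * S = - (S * H)" using SH car by simp
    also have "S' * (- (S * H)) * S' = - (S' * (S * H) * S')" using car by simp
    also have "S' * (S * H) = H" using mext[OF S'S] car by simp
    finally show ?thesis .
  qed
  have fT: "transpose_mat f = e" using eT by auto
  define a where "a = e * S"
  define b where "b = f * S'"
  have ac: "a \<in> carrier_mat n n" and bc: "b \<in> carrier_mat n n" using car by (auto simp: a_def b_def)
  have a': "a = S * f" and b': "b = S' * e" using eS fS' by (auto simp: a_def b_def)
  have t: "t = a + b + z" by (simp add: t_def a_def b_def)
  show "t \<in> carrier_mat n n" using ac bc car by (simp add: t)
  have aT: "transpose_mat a = a"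
    unfolding a_def using transpose_mult[OF car(1,4)] eT Ssym eS by simp
  have bT: "transpose_mat b = b"
    unfolding b_def using transpose_mult[OF car(2,5)] fT S'sym fS' by simp
  show "transpose_mat t = t"
    unfolding t using ac bc car aT bT zT
    by (simp add: transpose_add[of _ n n])
  have zero: "0\<^sub>m n n * X = 0\<^sub>m n n" "X * 0\<^sub>m n n = 0\<^sub>m n n" if "X \<in> carrier_mat n n" for X :: "complex mat"
    using that by auto
  have aa: "a * a = 0\<^sub>m n n"
  proof -
    have "a * a = S * (f * (e * S))" using car by (subst a', subst a_def) (simp add: am)
    thus ?thesis using mext[OF fe] car zero by simp
  qed
  have bb: "b * b = 0\<^sub>m n n"
  proof -
    have "b * b = S' * (e * (f * S'))" using car by (subst b', subst b_def) (simp add: am)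
    thus ?thesis using mext[OF ef] car zero by simp
  qed
  have ab: "a * b = e"
  proof -
    have "a * b = e * (S * (S' * e))" unfolding a_def b' using car by (simp add: am)
    thus ?thesis using mext[OF SS'] car ee by simp
  qed
  have ba: "b * a = f"
  proof -
    have "b * a = f * (S' * (S * f))" unfolding a' b_def using car by (simp add: am)
    thus ?thesis using mext[OF S'S] car ff by simp
  qed
  have az: "a * z = 0\<^sub>m n n" unfolding a' using car fz zero by (simp add: am)
  have bz: "b * z = 0\<^sub>m n n" unfolding b' using car ez zero by (simp add: am)
  have za: "z * a = 0\<^sub>m n n" unfolding a_def using mext[OF ze] car zero by simp
  have zb: "z * b = 0\<^sub>m n n" unfolding b_def using mext[OF zf] car zero by simp
  note dist = add_mult_distrib_mat[of _ n n _ _ n] mult_add_distrib_mat[of _ n n _ n]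
  have "f + (e + z) = e + f + z" using car by (intro eq_matI) auto
  thus "t * t = 1\<^sub>m n"
    unfolding t using ac bc car aa bb ab ba az bz za zb zz one
    by (simp add: dist)
  show "t * z = z"
    unfolding t using ac bc car az bz zz by (simp add: dist)
  have aH: "a * H = - (H * a)"
  proof -
    have "a * H = e * (S * H)" unfolding a_def using car by (simp add: am)
    also have "\<dots> = - (e * (H * S))" unfolding SH using car by simp
    also have "e * (H * S) = e * H * S" using car by (simp add: am)
    also have "\<dots> = H * a" unfolding He[symmetric] a_def using car by (simp add: am)
    finally show ?thesis .
  qed
  have bH: "b * H = - (H * b)"
  proof -
    have "b * H = f * (S' * H)" unfolding b_def using car by (simp add: am)
    also have "\<dots> = - (f * (H * S'))" unfolding S'H using car by simp
    also have "f * (H * S') = f * H * S'" using car by (simp add: am)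
    also have "\<dots> = H * b" unfolding Hf[symmetric] b_def using car by (simp add: am)
    finally show ?thesis .
  qed
  have "t * H = - (H * a) + - (H * b)"
    unfolding t using ac bc car aH bH zH by (simp add: dist)
  also have "\<dots> = - (H * t)"
    unfolding t using ac bc car Hz by (simp add: dist) (intro eq_matI, auto)
  finally show "t * H = - (H * t)" .
qed

text \<open>
  With \<open>H = P D P\<^sup>-\<^sup>1\<close>, the map \<open>S = P P\<^sup>T\<close> is the symmetric matrix required above: \<open>H S = P D P\<^sup>T\<close>
  is symmetric, and skewness of \<open>H\<close> turns this into \<open>S H = - H S\<close>. The Gram matrix \<open>G = P\<^sup>T P\<close>
  of the eigenbasis anticommutes with \<open>D\<close>, so that \<open>G\<^sub>i\<^sub>j\<close> vanishes unless \<open>d\<^sub>j = - d\<^sub>i\<close>. This is the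
  orthogonality of eigenspaces that makes the projections onto \<open>V\<close> and \<open>V'\<close> transposes of each other.
\<close>
lemma semisimple_skew_swap:
  fixes H :: "complex mat"
  assumes H: "H \<in> carrier_mat n n" and skew: "transpose_mat H = - H"
    and ss: "semisimple_mat H"
  obtains t z where "t \<in> carrier_mat n n" "transpose_mat t = t" "t * t = 1\<^sub>m n"
    "t * H = - (H * t)" "z \<in> carrier_mat n n" "transpose_mat z = z" "z * z = z"
    "H * z = 0\<^sub>m n n" "t * z = z" "det H = 0 \<Longrightarrow> z \<noteq> 0\<^sub>m n n"
proof -
  obtain D P Q where diag: "diagonal_mat D" and w: "similar_mat_wit H D P Q"
    using ss unfolding semisimple_mat_def similar_mat_def by blast
  note PQ = similar_mat_witD2[OF H w]
  note car = PQ(4-7)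
  note am = assoc_mult_mat[of _ n n _ n _ n]
  note mext = mult_eq_extend[where n = n]
  define d where "d i = D $$ (i, i)" for i
  have D: "D = mat_diag n d"
    using diag car by (intro eq_matI) (auto simp: mat_diag_def d_def diagonal_mat_def)
  \<comment> \<open>A half plane that contains exactly one of \<open>c\<close> and \<open>- c\<close> for every nonzero \<open>c\<close>.\<close>
  define pos :: "complex \<Rightarrow> bool" where "pos c \<longleftrightarrow> Re c > 0 \<or> Re c = 0 \<and> Im c > 0" for c
  have pos: "\<not> (pos c \<and> pos (- c))" "c \<noteq> 0 \<Longrightarrow> pos c \<or> pos (- c)" "\<not> pos 0" for c
    by (auto simp: pos_def complex_eq_iff)
  define E where "E = mat_diag n (\<lambda>i. if pos (d i) then 1 else 0 :: complex)"
  define F where "F = mat_diag n (\<lambda>i. if pos (- d i) then 1 else 0 :: complex)"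
  define Z where "Z = mat_diag n (\<lambda>i. if d i = 0 then 1 else 0 :: complex)"
  have EFZc: "E \<in> carrier_mat n n" "F \<in> carrier_mat n n" "Z \<in> carrier_mat n n"
    by (auto simp: E_def F_def Z_def)
  have diag0: "mat_diag n g = 0\<^sub>m n n" if "\<And>i. g i = 0" for g :: "nat \<Rightarrow> complex"
    using that by (intro eq_matI) (auto simp: mat_diag_def)
  have rel: "E * E = E" "F * F = F" "Z * Z = Z" "E * F = 0\<^sub>m n n" "F * E = 0\<^sub>m n n"
    "E * Z = 0\<^sub>m n n" "Z * E = 0\<^sub>m n n" "F * Z = 0\<^sub>m n n" "Z * F = 0\<^sub>m n n"
    "D * E = E * D" "D * F = F * D" "D * Z = 0\<^sub>m n n" "Z * D = 0\<^sub>m n n"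
    unfolding E_def F_def Z_def D using pos
    by (auto intro!: diag0 arg_cong[of _ _ "mat_diag n"] simp: mult.commute)
  have sumEFZ: "E + F + Z = 1\<^sub>m n"
    unfolding E_def F_def Z_def using pos by (intro eq_matI) (auto simp: mat_diag_def)
  define G where "G = transpose_mat P * P"
  have G: "G \<in> carrier_mat n n" using car by (simp add: G_def)
  define S where "S = P * transpose_mat P"
  define S' where "S' = transpose_mat Q * Q"
  have Sc: "S \<in> carrier_mat n n" "S' \<in> carrier_mat n n" using car by (auto simp: S_def S'_def)
  have PTQT: "transpose_mat P * transpose_mat Q = 1\<^sub>m n"
    using transpose_mult[OF car(4,3)] PQ(2) by simp
  have QTPT: "transpose_mat Q * transpose_mat P = 1\<^sub>m n"
    using transpose_mult[OF car(3,4)] PQ(1) by simp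
  have SS': "S * S' = 1\<^sub>m n"
    unfolding S_def S'_def using car mext[OF PTQT] PQ(1) by (simp add: am)
  have Ssym: "transpose_mat S = S"
    unfolding S_def using car transpose_mult[of P n n "transpose_mat P" n] by simp
  have DT: "transpose_mat D = D" unfolding D by (intro eq_matI) (auto simp: mat_diag_def)
  have HS: "H * S = P * D * transpose_mat P"
    unfolding S_def PQ(3) using car mext[OF PQ(2)] by (simp add: am)
  have "transpose_mat (H * S) = H * S"
    unfolding HS using car DT transpose_mult[of "P * D" n n "transpose_mat P" n]
      transpose_mult[of P n n D n] by (simp add: am)
  moreover have "transpose_mat (H * S) = - (S * H)"
    using transpose_mult[OF H Sc(1)] Ssym skew Sc H by simp
  ultimately have SH: "S * H = - (H * S)" using Sc H by (metis uminus_uminus_mat)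
  have DG: "D * G = - (G * D)"
  proof -
    have "H * P = P * D"
      by (subst PQ(3)) (use car PQ(2) in \<open>simp add: am\<close>)
    hence "transpose_mat H * P = - (P * D)"
      unfolding skew using car by simp
    hence "transpose_mat P * (transpose_mat H * P) = - (G * D)"
      unfolding G_def using car by (simp add: am)
    moreover have "transpose_mat H = transpose_mat Q * (D * transpose_mat P)"
      unfolding PQ(3) using car DT transpose_mult[of "P * D" n n Q n]
      transpose_mult[of P n n D n] by (simp add: am)
    ultimately show ?thesis
      unfolding G_def using car mext[OF PTQT] by (simp add: am)
  qed
  have dG: "d j = - d i" if "i < n" "j < n" "G $$ (i, j) \<noteq> 0" for i j
  proof -
    have "d i * G $$ (i, j) = - (G $$ (i, j) * d j)"
      using arg_cong[OF DG, of "\<lambda>A. A $$ (i, j)"] that G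
      by (simp add: D mat_diag_mult_left[OF G] mat_diag_mult_right[OF G])
    hence "G $$ (i, j) * (d i + d j) = 0" by (simp add: algebra_simps)
    thus ?thesis using that by (simp add: add_eq_0_iff)
  qed
  have EG: "E * G = G * F"
    unfolding E_def F_def mat_diag_mult_left[OF G] mat_diag_mult_right[OF G]
    using dG by (intro eq_matI) (auto, fastforce+)
  have ZG: "Z * G = G * Z"
    unfolding Z_def mat_diag_mult_left[OF G] mat_diag_mult_right[OF G]
    using dG by (intro eq_matI) (auto, fastforce+)
  \<comment> \<open>Passage from the eigenbasis to standard coordinates, a ring homomorphism. Transposition in
    standard coordinates becomes the adjoint with respect to \<open>G\<close> in the eigenbasis.\<close>
  define cj where "cj X = P * X * Q" for X
  have cjc: "cj X \<in> carrier_mat n n" if "X \<in> carrier_mat n n" for X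
    using that car by (simp add: cj_def)
  have cjm: "cj X * cj Y = cj (X * Y)" if "X \<in> carrier_mat n n" "Y \<in> carrier_mat n n" for X Y
    unfolding cj_def using that car mext[OF PQ(2)] by (simp add: am)
  have cj0: "cj (0\<^sub>m n n) = 0\<^sub>m n n" unfolding cj_def using car by simp
  have cjT: "transpose_mat (cj X) = cj Y"
    if XY: "X \<in> carrier_mat n n" "Y \<in> carrier_mat n n" "transpose_mat X = X" "X * G = G * Y" for X Y
  proof -
    have "transpose_mat (cj X) = transpose_mat Q * (X * transpose_mat P)"
      unfolding cj_def using car that transpose_mult[of "P * X" n n Q n]
        transpose_mult[of P n n X n] by (simp add: am)
    also have "\<dots> = transpose_mat Q * ((X * G) * Q)"
      unfolding G_def using car that PQ(1) by (simp add: am)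
    also have "\<dots> = transpose_mat Q * (transpose_mat P * (P * (Y * Q)))"
      unfolding XY(4) unfolding G_def using car that by (simp add: am)
    also have "\<dots> = cj Y"
      using mext[OF QTPT] car that by (simp add: cj_def am)
    finally show ?thesis .
  qed
  have eS: "cj E * S = S * cj F"
  proof -
    have "cj E * S = P * (E * transpose_mat P)"
      unfolding cj_def S_def using car EFZc mext[OF PQ(2)] by (simp add: am)
    also have "\<dots> = P * ((E * G) * Q)"
      unfolding G_def using car EFZc PQ(1) by (simp add: am)
    also have "\<dots> = S * cj F"
      unfolding EG unfolding G_def S_def cj_def using car EFZc by (simp add: am)
    finally show ?thesis .
  qed
  have symm: "transpose_mat E = E" "transpose_mat Z = Z"
    unfolding E_def Z_def by (intro eq_matI; auto simp: mat_diag_def)+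
  have one: "cj E + cj F + cj Z = 1\<^sub>m n"
  proof -
    have "cj E + cj F + cj Z = cj (E + F + Z)"
      unfolding cj_def using car EFZc
      by (simp add: add_mult_distrib_mat[of _ n n _ _ n] mult_add_distrib_mat[of _ n n _ n]
          assoc_add_mat[of _ n n])
    thus ?thesis unfolding sumEFZ using car PQ(1) by (simp add: cj_def)
  qed
  have Hcj: "H = cj D" using PQ(3) by (simp add: cj_def)
  have Hz: "H * cj Z = 0\<^sub>m n n" unfolding Hcj using car EFZc by (simp add: cjm rel cj0)
  note zT = cjT[OF EFZc(3,3) symm(2) ZG]
  define t where "t = cj E * S + cj F * S' + cj Z"
  \<comment> \<open>The open premises are products of diagonal matrices in the eigenbasis, carried over by \<open>cj\<close>.\<close>
  have main: "t \<in> carrier_mat n n" "transpose_mat t = t" "t * t = 1\<^sub>m n"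
    "t * H = - (H * t)" "t * cj Z = cj Z"
    unfolding t_def
    by ((rule swap_involution[OF cjc[OF EFZc(1)] cjc[OF EFZc(2)] cjc[OF EFZc(3)] Sc H one
          _ _ _ _ _ _ _ _ _ SS' Ssym cjT[OF EFZc(1,2) symm(1) EG] zT eS SH _ _ Hz],
        (use car EFZc in \<open>simp add: cjm rel cj0 Hcj\<close>)+)[1])+
  have nz: "cj Z \<noteq> 0\<^sub>m n n" if det: "det H = 0"
  proof
    assume z: "cj Z = 0\<^sub>m n n"
    have "Z = Q * (cj Z * P)"
      unfolding cj_def using mext[OF PQ(2)] PQ(2) car EFZc by (simp add: am)
    hence Z0: "Z = 0\<^sub>m n n" unfolding z using car by simp
    have "d i \<noteq> 0" if "i < n" for i
      using arg_cong[OF Z0, of "\<lambda>A. A $$ (i, i)"] that by (auto simp: Z_def mat_diag_def)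
    moreover have "det D = (\<Prod>i = 0..<n. d i)"
      using car diag by (subst det_upper_triangular[of _ n])
        (auto simp: diagonal_mat_def prod_list_diag_prod d_def)
    moreover have "det D = 0" using det_similar[of H D] w det unfolding similar_mat_def by auto
    ultimately show False by simp
  qed
  show thesis
    by (rule that[OF main(1-4) cjc[OF EFZc(3)] zT _ Hz main(5) nz]) (use EFZc in \<open>simp add: cjm rel\<close>)
qed

section \<open>Changing the determinant by a reflection in the kernel\<close>

text \<open>
  Polarization: a nonzero symmetric form \<open>z\<close> has a vector \<open>w\<close> with \<open>w\<^sup>T z w \<noteq> 0\<close>, namely a basis
  vector or a sum of two of them. The vector is returned as \<open>W = w w\<^sup>T\<close>, and the value of
  the form as the trace of \<open>z W\<close>.
\<close>
lemma symmetric_nonzero_anisotropic: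
  fixes z :: "complex mat"
  assumes z: "z \<in> carrier_mat n n" and sym: "transpose_mat z = z" and nz: "z \<noteq> 0\<^sub>m n n"
  obtains W where "W \<in> carrier_mat n n" "transpose_mat W = W"
    "W * (z * W) = mat_trace (z * W) \<cdot>\<^sub>m W" "mat_trace (z * W) \<noteq> 0"
proof -
  define R :: "(nat \<Rightarrow> complex) \<Rightarrow> complex mat" where "R w = mat n n (\<lambda>(i, j). w i * w j)" for w
  have Rc: "R w \<in> carrier_mat n n" for w by (simp add: R_def)
  have tr: "mat_trace (z * R w) = (\<Sum>k<n. (\<Sum>l<n. z $$ (k, l) * w l) * w k)" for w
    using z by (simp add: mat_trace_def R_def scalar_prod_def atLeast0LessThan mult.assoc sum_distrib_right)
  have "R w * (z * R w) = mat_trace (z * R w) \<cdot>\<^sub>m R w" for w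
    unfolding tr using z
    by (intro eq_matI) (auto simp: R_def scalar_prod_def atLeast0LessThan sum_distrib_left sum_distrib_right
        intro!: sum.cong)
  moreover have "transpose_mat (R w) = R w" for w by (intro eq_matI) (auto simp: R_def)
  moreover have "\<exists>w. mat_trace (z * R w) \<noteq> 0"
  proof -
    have zsym: "z $$ (j, i) = z $$ (i, j)" if "i < n" "j < n" for i j
      using arg_cong[OF sym, of "\<lambda>A. A $$ (i, j)"] that z by simp
    obtain i j where ij: "i < n" "j < n" "z $$ (i, j) \<noteq> 0"
      using nz z by (metis carrier_matD eq_matI index_zero_mat)
    show ?thesis
    proof (cases "\<exists>i<n. z $$ (i, i) \<noteq> 0")
      case True
      then obtain i where i: "i < n" "z $$ (i, i) \<noteq> 0" by blast
      have "mat_trace (z * R (\<lambda>k. if k = i then 1 else 0)) = z $$ (i, i)"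
        unfolding tr using i by (simp add: if_distrib[of "\<lambda>x. _ * x"] cong: if_cong)
      thus ?thesis using i by metis
    next
      case False
      hence ne: "i \<noteq> j" using ij by auto
      let ?w = "\<lambda>k. of_bool (k = i) + of_bool (k = j) :: complex"
      have "mat_trace (z * R ?w) = z $$ (i, i) + z $$ (i, j) + z $$ (j, i) + z $$ (j, j)"
        unfolding tr using ij ne
        by (simp add: distrib_left sum.distrib of_bool_def if_distrib[of "\<lambda>x. _ * x"] cong: if_cong)
      hence "mat_trace (z * R ?w) = 2 * z $$ (i, j)" using False ij zsym by simp
      thus ?thesis using ij by (metis mult_eq_0_iff zero_neq_numeral)
    qed
  qed
  ultimately show thesis using that Rc by blast
qed

text \<open>
  If \<open>W = w w\<^sup>T\<close>, then \<open>z W z = v v\<^sup>T\<close> with \<open>v = z w\<close> in the image of \<open>z\<close>. There \<open>H\<close> vanishes and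
  \<open>t\<close> is the identity, and \<open>c = v\<^sup>T v \<noteq> 0\<close>. The new involution is the product of \<open>t\<close> with
  the reflection \<open>1 - (2/c) v v\<^sup>T\<close>; as \<open>t v = v\<close>, this product is \<open>t - (2/c) v v\<^sup>T\<close>.
\<close>
lemma reflect_involution:
  fixes t z H :: "complex mat"
  assumes t: "t \<in> carrier_mat n n" and tT: "transpose_mat t = t" and tt: "t * t = 1\<^sub>m n"
    and H: "H \<in> carrier_mat n n" and skew: "transpose_mat H = - H" and anti: "t * H = - (H * t)"
    and z: "z \<in> carrier_mat n n" and zT: "transpose_mat z = z" and zz: "z * z = z"
    and Hz: "H * z = 0\<^sub>m n n" and tz: "t * z = z" and nz: "z \<noteq> 0\<^sub>m n n"
  obtains t' where "t' \<in> carrier_mat n n" "transpose_mat t' = t'" "t' * t' = 1\<^sub>m n"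
    "t' * H = - (H * t')" "mat_trace t' = mat_trace t - 2"
proof -
  obtain W where W: "W \<in> carrier_mat n n" and WT: "transpose_mat W = W"
    and WzW: "W * (z * W) = mat_trace (z * W) \<cdot>\<^sub>m W" and c0: "mat_trace (z * W) \<noteq> 0"
    using symmetric_nonzero_anisotropic[OF z zT nz] by blast
  note am = assoc_mult_mat[of _ n n _ n _ n]
  note mext = mult_eq_extend[where n = n]
  define c where "c = mat_trace (z * W)"
  define N where "N = z * (W * z)"
  have N: "N \<in> carrier_mat n n" using z W by (simp add: N_def)
  have NT: "transpose_mat N = N"
    unfolding N_def using z W zT WT transpose_mult[of z n n "W * z" n] transpose_mult[of W n n z n]
    by (simp add: am)
  have tN: "t * N = N" unfolding N_def using mext[OF tz] t z W by simp
  have Nt: "N * t = N" using transpose_mult[OF t N] tN NT tT by simp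
  have HN: "H * N = 0\<^sub>m n n" unfolding N_def using mext[OF Hz] H z W by simp
  have NH: "N * H = 0\<^sub>m n n"
  proof -
    have "transpose_mat (H * N) = - (N * H)" using transpose_mult[OF H N] NT skew N H by simp
    hence "- (N * H) = 0\<^sub>m n n" unfolding HN by simp
    hence "N * H = - 0\<^sub>m n n" using N H by (metis uminus_uminus_mat)
    thus ?thesis by auto
  qed
  have NN: "N * N = c \<cdot>\<^sub>m N"
  proof -
    have "N * N = z * ((W * (z * W)) * z)"
      unfolding N_def using z W mext[OF zz] by (simp add: am)
    also have "\<dots> = z * ((c \<cdot>\<^sub>m W) * z)" unfolding WzW c_def by simp
    also have "\<dots> = c \<cdot>\<^sub>m N"
      unfolding N_def using z W
      by (simp add: mult_smult_assoc_mat[of _ n n _ n] mult_smult_distrib[of _ n n _ n])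
    finally show ?thesis .
  qed
  have trN: "mat_trace N = c"
  proof -
    have "mat_trace N = mat_trace ((W * z) * z)"
      unfolding N_def using z W by (intro mat_trace_mult_commute[of _ n n]) auto
    also have "\<dots> = mat_trace (W * z)" using z W zz by (simp add: am)
    also have "\<dots> = c" unfolding c_def using z W by (intro mat_trace_mult_commute[of _ n n]) auto
    finally show ?thesis .
  qed
  define k where "k = - 2 / c"
  define t' where "t' = t + k \<cdot>\<^sub>m N"
  have kc: "k * c = - 2" using c0 by (simp add: k_def c_def)
  note dist = add_mult_distrib_mat[of _ n n _ _ n] mult_add_distrib_mat[of _ n n _ n]
    mult_smult_assoc_mat[of _ n n _ n] mult_smult_distrib[of _ n n _ n]
  show thesis
  proof
    show "t' \<in> carrier_mat n n" using t N by (simp add: t'_def)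
    have "transpose_mat (k \<cdot>\<^sub>m N) = k \<cdot>\<^sub>m transpose_mat N" by (intro eq_matI) auto
    thus "transpose_mat t' = t'" using t N tT NT by (simp add: t'_def transpose_add[of _ n n])
    have "t' * t' = 1\<^sub>m n + k \<cdot>\<^sub>m N + k \<cdot>\<^sub>m (N + k \<cdot>\<^sub>m (c \<cdot>\<^sub>m N))"
      unfolding t'_def using t N tt tN Nt NN by (simp add: dist)
    also have "\<dots> = 1\<^sub>m n"
    proof (rule eq_matI)
      fix i j assume ij: "i < dim_row (1\<^sub>m n :: complex mat)" "j < dim_col (1\<^sub>m n :: complex mat)"
      have "k * x + k * (x + k * (c * x)) = 0" for x
      proof -
        have "k * x + k * (x + k * (c * x)) = k * x * (2 + k * c)" by (simp add: algebra_simps)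
        thus ?thesis using kc by simp
      qed
      thus "(1\<^sub>m n + k \<cdot>\<^sub>m N + k \<cdot>\<^sub>m (N + k \<cdot>\<^sub>m (c \<cdot>\<^sub>m N))) $$ (i, j) = 1\<^sub>m n $$ (i, j)"
        using ij N by (simp add: add.assoc)
    qed (use N in auto)
    finally show "t' * t' = 1\<^sub>m n" .
    show "t' * H = - (H * t')"
      unfolding t'_def using t N H anti HN NH by (simp add: dist)
    have "mat_trace t' = mat_trace t + k * mat_trace N"
      using t N by (simp add: t'_def mat_trace_def sum.distrib sum_distrib_left)
    thus "mat_trace t' = mat_trace t - 2" by (simp add: trN kc)
  qed
qed

section \<open>The criterion\<close>

theorem theorem3p9:
  fixes n :: nat and H :: "complex mat"
  assumes "n > 0"
    and "H \<in> so_alg n"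
    and "semisimple_mat H"
  shows "strongly_Ad_real (SO n) H \<longleftrightarrow> eigenvalue H 0 \<or> \<not> [n = 2] (mod 4)"
proof -
  have H: "H \<in> carrier_mat n n" and HT: "transpose_mat H + H = 0\<^sub>m n n"
    using assms(2) by (auto simp: so_alg_def sl_alg_def)
  have skew: "transpose_mat H = - H"
  proof (rule eq_matI)
    fix i j assume "i < dim_row (- H)" "j < dim_col (- H)"
    thus "transpose_mat H $$ (i, j) = (- H) $$ (i, j)"
      using arg_cong[OF HT, of "\<lambda>A. A $$ (i, j)"] H by (simp add: eq_neg_iff_add_eq_0)
  qed (use H in auto)
  have anti_det: "det t = 1 \<longleftrightarrow> \<not> [n = 2] (mod 4)"
    if t: "t \<in> carrier_mat n n" "t * t = 1\<^sub>m n" "t * H = - (H * t)" and det: "det H \<noteq> 0" for t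
  proof -
    obtain q where q: "mat_trace t = of_nat n - 2 * of_nat q" "det t = (-1) ^ q"
      using involution_trace_det[OF t(1,2)] .
    have "(of_nat n :: complex) = of_nat (2 * q)"
      using q(1) mat_trace_anticommuting_zero[OF t(1) H det t(3)] by simp
    hence "n = 2 * q" unfolding of_nat_eq_iff .
    hence "[n = 2] (mod 4) \<longleftrightarrow> odd q" unfolding cong_def by presburger
    thus ?thesis unfolding q(2) by (auto simp: minus_one_power_iff)
  qed
  obtain t z where t: "t \<in> carrier_mat n n" "transpose_mat t = t" "t * t = 1\<^sub>m n" "t * H = - (H * t)"
    and z: "z \<in> carrier_mat n n" "transpose_mat z = z" "z * z = z" "H * z = 0\<^sub>m n n" "t * z = z"
      "det H = 0 \<Longrightarrow> z \<noteq> 0\<^sub>m n n"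
    using semisimple_skew_swap[OF H skew assms(3)] by blast
  show ?thesis
  proof (cases "det H = 0")
    case False
    thus ?thesis
      unfolding strongly_Ad_real_SO_iff[OF H] eigenvalue_0_iff_det[OF H]
      using anti_det t by blast
  next
    case True
    obtain t' where t': "t' \<in> carrier_mat n n" "transpose_mat t' = t'" "t' * t' = 1\<^sub>m n"
      "t' * H = - (H * t')" and tr: "mat_trace t' = mat_trace t - 2"
      using reflect_involution[OF t(1-3) H skew t(4) z(1-5) z(6)[OF True]] .
    obtain q where q: "mat_trace t = of_nat n - 2 * of_nat q" "det t = (-1) ^ q"
      using involution_trace_det[OF t(1,3)] .
    obtain q' where q': "mat_trace t' = of_nat n - 2 * of_nat q'" "det t' = (-1) ^ q'"
      using involution_trace_det[OF t'(1,3)] .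
    have "- (2 * of_nat q') = - (2 * of_nat q + 2 :: complex)" using tr q(1) q'(1) by simp
    hence "(of_nat (2 * q') :: complex) = of_nat (2 * q + 2)"
      unfolding neg_equal_iff_equal by simp
    hence "q' = q + 1" unfolding of_nat_eq_iff by simp
    hence "det t = 1 \<or> det t' = 1" using q(2) q'(2) by (cases "even q") auto
    thus ?thesis
      unfolding strongly_Ad_real_SO_iff[OF H] eigenvalue_0_iff_det[OF H]
      using True t t' by blast
  qed
qed

end
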